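(* For every integer $n\ge0$, $\beta\in\mathbb{C}$ and $0\le p\le n$, with $H_n^{\beta}=F_nE^{n\beta}F_n^{-1}$, $$H_n^{\beta}x^p=\sum_{m=p}^{n}\binom{n+m}{m}^{-1}\binom{n-p}{n-m}(1-x)^{n-m}\,t_m\big(-n\beta+n+m\,\big|\,n\beta,x\big),$$ where $t_m(\varphi\,|\,\gamma,x)=\sum_{k=0}^{m}\binom{\varphi}{k}\binom{\gamma}{m-k}x^k$.
   Context: Polynomials over $\mathbb{C}$; $\binom{y}{k}=y(y-1)\cdots(y-k+1)/k!$ for $k\ge0$. $F_n$ is the linear map on polynomials of degree at most $n$ with $F_nx^p=(1-x)^{2n+1}\sum_{m\ge0}m^p\binom{m+n}{n}x^m$ ($0^0=1$), inverse $F_n^{-1}x^p=\frac{n!}{(2n)!}(x)_p[x+n+1]_{n-p}$, where $(y)_p=y(y-1)\cdots(y-p+1)$, $[y]_k=y(y+1)\cdots(y+k-1)$. $E^{\gamma}c(x)=c(x+\gamma)$. *)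

theory Defs
  imports Complex_Main "HOL-Computational_Algebra.Computational_Algebra"
begin

(* The series is an element of the formal power series ring; for p \<le> n the product is a
   polynomial of degree at most n (F_monom_wd below), so the description is proper.
   In Isabelle 0 ^ 0 = 1, as required for p = m = 0. *)
definition F_monom :: "nat \<Rightarrow> nat \<Rightarrow> complex poly" where
  "F_monom n p = (THE q. fps_of_poly q =
     (1 - fps_X) ^ (2 * n + 1) *
     Abs_fps (\<lambda>m. of_nat m ^ p * of_nat ((m + n) choose n)))"

(* The linear extension of F_monom to polynomials of degree at most n; coefficients of
   higher order are ignored, so F_op n is only meaningful for degree c \<le> n. *)
definition F_op :: "nat \<Rightarrow> complex poly \<Rightarrow> complex poly" where
  "F_op n c = (\<Sum>p\<le>n. smult (coeff c p) (F_monom n p))"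

(* The inverse on the space of polynomials of degree at most n; F_op n is injective there
   (inj_on_F_op), and F_inv_monom_eq gives its explicit values on the monomials. *)
definition F_inv :: "nat \<Rightarrow> complex poly \<Rightarrow> complex poly" where
  "F_inv n = inv_into {c. degree c \<le> n} (F_op n)"

(* E^gamma c(x) = c(x + gamma) *)
definition shift :: "complex \<Rightarrow> complex poly \<Rightarrow> complex poly" where
  "shift \<gamma> c = pcompose c [:\<gamma>, 1:]"

definition H_op :: "nat \<Rightarrow> complex \<Rightarrow> complex poly \<Rightarrow> complex poly" where
  "H_op n \<beta> c = F_op n (shift (of_nat n * \<beta>) (F_inv n c))"

(* t_m(phi | gamma, x) as a polynomial in x; gchoose is y(y-1)...(y-k+1)/k! for complex y. *)
definition t_poly :: "nat \<Rightarrow> complex \<Rightarrow> complex \<Rightarrow> complex poly" where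
  "t_poly m \<phi> \<gamma> = (\<Sum>k\<le>m. monom ((\<phi> gchoose k) * (\<gamma> gchoose (m - k))) k)"

lemma fps_binomial_series:
  "(1 - fps_X) ^ (n + 1) * Abs_fps (\<lambda>m. of_nat ((m + n) choose n)) = (1 :: complex fps)"
proof (induction n)
  case 0
  have "Abs_fps (\<lambda>m. 1) * (1 - fps_X) = (1 :: complex fps)"
    by (rule fps_ext) (auto simp: algebra_simps fps_X_mult_nth)
  then show ?case by (simp add: mult.commute)
next
  case (Suc n)
  have "(1 - fps_X) * Abs_fps (\<lambda>m. of_nat ((m + Suc n) choose Suc n))
          = (Abs_fps (\<lambda>m. of_nat ((m + n) choose n)) :: complex fps)"
  proof (rule fps_ext)
    fix m
    show "fps_nth ((1 - fps_X) * Abs_fps (\<lambda>m. of_nat ((m + Suc n) choose Suc n))) m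
            = (fps_nth (Abs_fps (\<lambda>m. of_nat ((m + n) choose n))) m :: complex)"
      by (cases m) (auto simp: left_diff_distrib)
  qed
  then show ?case using Suc by (simp add: mult.assoc power_Suc2 del: power_Suc)
qed

lemma F_monom_aux:
  "\<exists>q :: complex poly. degree q \<le> p \<and>
     fps_of_poly q = (1 - fps_X) ^ (n + p + 1) *
       Abs_fps (\<lambda>m. of_nat m ^ p * of_nat ((m + n) choose n))"
proof (induction p)
  case 0
  show ?case by (intro exI[of _ 1]) (simp add: fps_binomial_series[simplified])
next
  case (Suc p)
  define S where "S = (\<lambda>p. Abs_fps (\<lambda>m. of_nat m ^ p * of_nat ((m + n) choose n)) :: complex fps)"
  define N where "N = n + p"
  from Suc obtain q where q: "degree q \<le> p" "fps_of_poly q = (1 - fps_X) ^ Suc N * S p"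
    by (auto simp: S_def N_def)
  have S: "S (Suc p) = fps_X * fps_deriv (S p)"
  proof (rule fps_ext)
    fix m show "fps_nth (S (Suc p)) m = fps_nth (fps_X * fps_deriv (S p)) m"
      by (cases m) (auto simp: S_def)
  qed
  define r where "r = [:0, 1:] * (pderiv q * [:1, -1:] + smult (of_nat (Suc N)) q)"
  have "fps_of_poly (pderiv q) = fps_deriv ((1 - fps_X) ^ Suc N * S p)"
    by (simp only: fps_of_poly_pderiv q(2))
  also have "\<dots> = (1 - fps_X) ^ Suc N * fps_deriv (S p)
                  - of_nat (Suc N) * (1 - fps_X) ^ N * S p"
    by (simp add: fps_deriv_power' algebra_simps del: power_Suc of_nat_Suc)
  finally have d: "fps_of_poly (pderiv q) = \<dots>" .
  have "fps_of_poly r = (1 - fps_X) ^ (Suc (Suc N)) * S (Suc p)"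
  proof -
    have "fps_of_poly [:1, -1:] = (1 - fps_X :: complex fps)"
      by (simp add: fps_of_poly_pCons)
    moreover have "fps_of_poly [:0, 1:] = (fps_X :: complex fps)"
      by (simp add: fps_of_poly_pCons)
    ultimately have "fps_of_poly r = fps_X * (fps_of_poly (pderiv q) * (1 - fps_X)
                       + of_nat (Suc N) * fps_of_poly q)"
      unfolding r_def by (simp only: fps_of_poly_mult fps_of_poly_add fps_of_poly_smult fps_of_nat)
    also have "\<dots> = (1 - fps_X) ^ (Suc (Suc N)) * S (Suc p)"
      unfolding d q(2) S power_Suc by (simp only: ring_distribs mult_ac) simp
    finally show ?thesis .
  qed
  moreover have "degree r \<le> Suc p"
  proof -
    have "degree (pderiv q * [:1, -1:]) \<le> p"
    proof (cases "p = 0")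
      case True
      then have "pderiv q = 0" using q(1) by (simp add: pderiv_eq_0_iff)
      then show ?thesis by simp
    next
      case False
      then show ?thesis using degree_mult_le[of "pderiv q" "[:1, -1:]"] q(1)
        by (simp add: degree_pderiv)
    qed
    then have "degree (pderiv q * [:1, -1:] + smult (of_nat (Suc N)) q) \<le> p"
      using q(1) by (intro degree_add_le) (auto intro: order_trans[OF degree_smult_le])
    then show ?thesis unfolding r_def
      using degree_mult_le[of "[:0, 1:]" "pderiv q * [:1, -1:] + smult (of_nat (Suc N)) q"] 
      by (simp del: of_nat_Suc)
  qed
  ultimately show ?case unfolding S_def N_def by (intro exI[of _ r]) simp
qed

lemma F_monom_wd:
  assumes "p \<le> n"
  shows "fps_of_poly (F_monom n p) =
           (1 - fps_X) ^ (2 * n + 1) * Abs_fps (\<lambda>m. of_nat m ^ p * of_nat ((m + n) choose n))"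
    and "degree (F_monom n p) \<le> n"
proof -
  obtain q :: "complex poly" where q: "degree q \<le> p" 
     "fps_of_poly q = (1 - fps_X) ^ (n + p + 1) *
       Abs_fps (\<lambda>m. of_nat m ^ p * of_nat ((m + n) choose n))"
    using F_monom_aux by blast
  define r where "r = [:1, -1:] ^ (n - p) * q"
  have "2 * n + 1 = (n - p) + (n + p + 1)" using assms by simp
  then have r: "fps_of_poly r = (1 - fps_X) ^ (2 * n + 1) *
       Abs_fps (\<lambda>m. of_nat m ^ p * of_nat ((m + n) choose n))"
    unfolding r_def by (simp only: power_add fps_of_poly_mult q mult.assoc)
      (simp add: fps_of_poly_power fps_of_poly_pCons mult.assoc)
  have "F_monom n p = r"
    unfolding F_monom_def using r by (intro the_equality) (simp_all only: fps_of_poly_eq_iff flip: r)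
  moreover have "degree r \<le> n"
    using degree_mult_le[of "[:1, -1:] ^ (n - p)" q] q(1) assms degree_power_le[of "[:1,-1::complex:]" "n - p"]
    unfolding r_def by simp
  ultimately show "fps_of_poly (F_monom n p) =
           (1 - fps_X) ^ (2 * n + 1) * Abs_fps (\<lambda>m. of_nat m ^ p * of_nat ((m + n) choose n))"
    and "degree (F_monom n p) \<le> n" using r by auto
qed

lemma fps_of_poly_F_op:
  assumes "degree c \<le> n"
  shows "fps_of_poly (F_op n c) =
           (1 - fps_X) ^ (2 * n + 1) * Abs_fps (\<lambda>m. poly c (of_nat m) * of_nat ((m + n) choose n))"
proof -
  have "fps_of_poly (F_op n c) = (\<Sum>p\<le>n. fps_const (coeff c p) * ((1 - fps_X) ^ (2 * n + 1) *
          Abs_fps (\<lambda>m. of_nat m ^ p * of_nat ((m + n) choose n))))"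
    unfolding F_op_def by (simp add: fps_of_poly_sum fps_of_poly_smult F_monom_wd(1) del: power_Suc)
  also have "\<dots> = (1 - fps_X) ^ (2 * n + 1) * (\<Sum>p\<le>n. fps_const (coeff c p) *
          Abs_fps (\<lambda>m. of_nat m ^ p * of_nat ((m + n) choose n)))"
    by (simp add: sum_distrib_left mult_ac del: power_Suc)
  also have "(\<Sum>p\<le>n. fps_const (coeff c p) * Abs_fps (\<lambda>m. of_nat m ^ p * of_nat ((m + n) choose n)))
     = Abs_fps (\<lambda>m. poly c (of_nat m) * of_nat ((m + n) choose n))"
  proof (rule fps_ext)
    fix m
    have "poly c (of_nat m) = (\<Sum>p\<le>n. coeff c p * of_nat m ^ p)"
      using assms by (subst poly_as_sum_of_monoms'[OF assms, symmetric])
        (simp add: poly_sum poly_monom)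
    then show "fps_nth (\<Sum>p\<le>n. fps_const (coeff c p) *
       Abs_fps (\<lambda>m. of_nat m ^ p * of_nat ((m + n) choose n))) m =
       fps_nth (Abs_fps (\<lambda>m. poly c (of_nat m) * of_nat ((m + n) choose n))) m"
      by (simp add: fps_sum_nth sum_distrib_right mult.assoc)
  qed
  finally show ?thesis .
qed

lemma inj_on_F_op: "inj_on (F_op n) {c. degree c \<le> n}"
proof (rule inj_onI, simp only: mem_Collect_eq)
  fix c d :: "complex poly"
  assume cd: "degree c \<le> n" "degree d \<le> n" "F_op n c = F_op n d"
  have "fps_nth (1 - fps_X :: complex fps) 0 \<noteq> 0" by simp
  then have "1 - fps_X \<noteq> (0 :: complex fps)" by fastforce
  then have "Abs_fps (\<lambda>m. poly c (of_nat m) * of_nat ((m + n) choose n)) =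
      Abs_fps (\<lambda>m. poly d (of_nat m) * of_nat ((m + n) choose n))"
    using fps_of_poly_F_op[OF cd(1)] fps_of_poly_F_op[OF cd(2)] cd(3) by auto
  from arg_cong[OF this, of fps_nth, THEN fun_cong]
  have "poly c (of_nat m) * of_nat ((m + n) choose n) =
      poly d (of_nat m) * of_nat ((m + n) choose n)" for m
    by (simp only: fps_nth_Abs_fps)
  then have eq: "poly c (of_nat m) = poly d (of_nat m)" for m by simp
  show "c = d"
  proof (rule ccontr)
    assume "c \<noteq> d"
    then have "finite {z. poly (c - d) z = 0}" by (intro poly_roots_finite) simp
    moreover have "range of_nat \<subseteq> {z. poly (c - d) z = 0}" using eq by auto
    ultimately have "finite (range (of_nat :: nat \<Rightarrow> complex))" by (rule rev_finite_subset)
    then show False by (simp add: range_inj_infinite inj_of_nat)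
  qed
qed

(* n!/(2n)! (x)_p [x+n+1]_{n-p}, with falling and rising factorials in the variable x. *)
definition F_inv_monom :: "nat \<Rightarrow> nat \<Rightarrow> complex poly" where
  "F_inv_monom n p = smult (fact n / fact (2 * n))
     ((\<Prod>i<p. [:- of_nat i, 1:]) * (\<Prod>i<n - p. [:of_nat (n + 1 + i), 1:]))"

lemma degree_F_inv_monom: "p \<le> n \<Longrightarrow> degree (F_inv_monom n p) \<le> n"
  unfolding F_inv_monom_def
  by (intro order_trans[OF degree_smult_le] order_trans[OF degree_mult_le])
     (simp add: degree_prod_eq_sum_degree)

lemma F_op_F_inv_monom:
  assumes "p \<le> n"
  shows "F_op n (F_inv_monom n p) = monom 1 p"
proof -
  have desc: "(\<Prod>i<p. of_nat m - of_nat i) * fact (m - p) = (fact m :: complex)" if "p \<le> m" for m p :: nat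
    using that
  proof (induction p)
    case (Suc p)
    have "(fact (m - p) :: complex) = (of_nat m - of_nat p) * fact (m - Suc p)"
      using Suc.prems by (subst Suc_diff_Suc[symmetric]) (auto simp: of_nat_diff)
    then show ?case using Suc by (simp add: mult_ac)
  qed simp
  have asc: "fact m * (\<Prod>i<k. of_nat m + (1 + of_nat i)) = (fact (m + k) :: complex)" for m k :: nat
  proof (induction k)
    case (Suc k)
    have "fact m * (\<Prod>i<Suc k. of_nat m + (1 + of_nat i)) = fact (m + k) * (of_nat (m + k + 1) :: complex)"
      using Suc by (simp add: mult.assoc [symmetric] add_ac)
    then show ?case by (simp add: mult.commute)
  qed simp
  have "poly (F_inv_monom n p) (of_nat m) * of_nat ((m + n) choose n) =
        (if m < p then 0 else of_nat ((m - p + 2 * n) choose (2 * n)))" for m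
  proof (cases "m < p")
    case True
    then show ?thesis by (auto simp: F_inv_monom_def poly_prod intro!: bexI[of _ m])
  next
    case False
    define A where "A = (\<Prod>i<p. of_nat m - of_nat i :: complex)"
    define B where "B = (\<Prod>i<n - p. of_nat (m + n) + (1 + of_nat i) :: complex)"
    have A: "A = fact m / fact (m - p)" using desc[of p m] False by (simp add: A_def field_simps)
    have "m + n + (n - p) = m + 2 * n - p" using assms by simp
    then have B: "B = fact (m + 2 * n - p) / fact (m + n)"
      using asc[of "m + n" "n - p"] unfolding B_def
      by (simp only: nonzero_eq_divide_eq fact_nonzero not_False_eq_True mult.commute)
    have P: "poly (F_inv_monom n p) (of_nat m) = fact n / fact (2 * n) * (A * B)"
      by (simp add: F_inv_monom_def poly_prod A_def B_def algebra_simps)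
    have c1: "(of_nat ((m + n) choose n) :: complex) = fact (m + n) / (fact n * fact m)"
      by (subst binomial_fact) auto
    have c2: "(of_nat ((m - p + 2 * n) choose (2 * n)) :: complex) =
        fact (m + 2 * n - p) / (fact (2 * n) * fact (m - p))"
      using False by (subst binomial_fact) auto
    show ?thesis using False unfolding P A B c1 c2 by simp
  qed
  then have "Abs_fps (\<lambda>m. poly (F_inv_monom n p) (of_nat m) * of_nat ((m + n) choose n)) =
      fps_X ^ p * Abs_fps (\<lambda>m. of_nat ((m + 2 * n) choose (2 * n)))"
    by (intro fps_ext) (simp add: fps_X_power_mult_nth)
  moreover have "(1 - fps_X) ^ (2 * n + 1) * Abs_fps (\<lambda>m. of_nat ((m + 2 * n) choose (2 * n))) = (1 :: complex fps)"
    by (rule fps_binomial_series)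
  ultimately have "fps_of_poly (F_op n (F_inv_monom n p)) = fps_X ^ p"
    using fps_of_poly_F_op[OF degree_F_inv_monom[OF assms]] by (simp add: mult_ac)
  also have "\<dots> = fps_of_poly (monom 1 p)" by (simp add: fps_of_poly_monom)
  finally show ?thesis by (simp only: fps_of_poly_eq_iff)
qed

lemma F_inv_monom_eq:
  assumes "p \<le> n"
  shows "F_inv n (monom 1 p) = F_inv_monom n p"
  unfolding F_inv_def using F_op_F_inv_monom[OF assms] degree_F_inv_monom[OF assms]
  by (intro inv_into_f_eq inj_on_F_op) auto

end

theory Submission
  imports Defs
begin

text \<open>
  Writing \<open>1 + x z = (1 + z) - z (1 - x)\<close> in the generating function
  \<open>(1 + x z)\<^sup>\<phi> (1 + z)\<^sup>\<gamma>\<close> of the \<open>t\<^sub>m\<close> expands \<open>t\<^sub>m\<close> in powers of \<open>1 - x\<close>.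
  For \<open>\<phi> + \<gamma> = n + m\<close>, division by \<open>(1 - x)\<^bsup>n+m+1\<^esup>\<close> and Vandermonde's convolution then
  show that \<open>(1 - x)\<^bsup>n-m\<^esup> t\<^sub>m\<close> is the image under \<open>F\<^sub>n\<close> of \<open>binom(x + \<gamma>, m)\<close>, and a second
  Vandermonde convolution expands \<open>F\<^sub>n\<^sup>-\<^sup>1 x\<^sup>p\<close> in the binomials \<open>binom(x, m)\<close>.
\<close>

text \<open>Negating the upper index turns the second factor into \<open>(-1) ^ (m - i)\<close>
  times a binomial with upper index \<open>m - 1 - b\<close>, free of \<open>i\<close>. All signs
  merge into \<open>(-1) ^ m\<close>, ordinary Vandermonde applies, and a second negation absorbs
  that sign. This one identity serves both for the coefficients of \<open>t_poly\<close> and for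
  those of the series.\<close>

lemma gbinomial_Vandermonde_alternating:
  fixes a b :: "'a :: field_char_0"
  shows "(\<Sum>i\<le>m. (-1) ^ i * (a gchoose i) * ((b - of_nat i) gchoose (m - i))) = (b - a) gchoose m"
proof -
  have "(-1) ^ i * (a gchoose i) * ((b - of_nat i) gchoose (m - i)) =
      (-1) ^ m * ((a gchoose i) * ((of_nat m - 1 - b) gchoose (m - i)))" if "i \<le> m" for i
  proof -
    have "(b - of_nat i) gchoose (m - i) = (-1) ^ (m - i) * ((of_nat m - 1 - b) gchoose (m - i))"
      using that by (subst gbinomial_negated_upper) (simp add: of_nat_diff algebra_simps)
    moreover have "(-1 :: 'a) ^ m = (-1) ^ i * (-1) ^ (m - i)"
      using that by (simp flip: power_add)
    ultimately show ?thesis by simp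
  qed
  then have "(\<Sum>i\<le>m. (-1) ^ i * (a gchoose i) * ((b - of_nat i) gchoose (m - i))) =
      (-1) ^ m * (\<Sum>i\<le>m. (a gchoose i) * ((of_nat m - 1 - b) gchoose (m - i)))"
    unfolding sum_distrib_left by (auto intro!: sum.cong simp only: atMost_iff)
  also have "\<dots> = (-1) ^ m * ((a + (of_nat m - 1 - b)) gchoose m)"
    by (simp add: gbinomial_Vandermonde flip: atLeast0AtMost)
  also have "\<dots> = (b - a) gchoose m"
    by (subst (2) gbinomial_negated_upper) (simp add: algebra_simps)
  finally show ?thesis .
qed

lemma coeff_one_minus_power:
  "coeff ([:1, -1:] ^ i) k = ((-1) ^ k * of_nat (i choose k) :: 'a :: comm_ring_1)"
proof (cases "k \<le> i")
  case False
  have "degree ([:1, -1 :: 'a:] ^ i) \<le> i"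
    using degree_power_le[of "[:1, -1 :: 'a:]" i] by simp
  then show ?thesis using False by (simp add: coeff_eq_0 binomial_eq_0)
qed (simp add: coeff_linear_poly_power)

text \<open>Checked on the coefficient of x^k: trinomial revision pulls
  \<open>\<phi> gchoose k\<close> out of every term, and what remains is the alternating convolution
  with a = \<phi> - k and b = \<phi> + \<gamma> - k, whose value has upper index b - a =
  \<gamma>.\<close>

lemma t_poly_expand_at_one:
  "t_poly m \<phi> \<gamma> = (\<Sum>i\<le>m. smult ((-1) ^ i * (\<phi> gchoose i) * ((\<phi> + \<gamma> - of_nat i) gchoose (m - i)))
     ([:1, -1:] ^ i))"
proof (rule poly_eqI)
  fix k
  let ?g = "\<lambda>i. (-1) ^ i * (\<phi> gchoose i) * ((\<phi> + \<gamma> - of_nat i) gchoose (m - i))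
     * ((-1) ^ k * of_nat (i choose k))"
  have rhs: "coeff (\<Sum>i\<le>m. smult ((-1) ^ i * (\<phi> gchoose i) * ((\<phi> + \<gamma> - of_nat i) gchoose (m - i)))
     ([:1, -1:] ^ i)) k = (\<Sum>i\<le>m. ?g i)"
    by (simp add: coeff_sum coeff_one_minus_power)
  have lhs: "coeff (t_poly m \<phi> \<gamma>) k = (if k \<le> m then (\<phi> gchoose k) * (\<gamma> gchoose (m - k)) else 0)"
    by (simp add: t_poly_def coeff_sum)
  show "coeff (t_poly m \<phi> \<gamma>) k = coeff (\<Sum>i\<le>m. smult ((-1) ^ i * (\<phi> gchoose i) *
     ((\<phi> + \<gamma> - of_nat i) gchoose (m - i))) ([:1, -1:] ^ i)) k"
  proof (cases "k \<le> m")
    case False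
    then show ?thesis unfolding lhs rhs by (auto intro!: sum.neutral simp: binomial_eq_0)
  next
    case True
    \<comment> \<open>Terms with i < k vanish because \<open>i choose k\<close> does.\<close>
    have "(\<Sum>i\<le>m. ?g i) = (\<Sum>i\<in>{k..m}. ?g i)"
      by (rule sum.mono_neutral_right) auto
    also have "\<dots> = (\<Sum>i\<le>m - k. ?g (i + k))"
      using True by (intro sum.reindex_bij_witness[of _ "\<lambda>i. i + k" "\<lambda>i. i - k"]) auto
    also have "\<dots> = (\<Sum>i\<le>m - k. (\<phi> gchoose k) * ((-1) ^ i * ((\<phi> - of_nat k) gchoose i) *
        ((\<phi> + \<gamma> - of_nat k - of_nat i) gchoose (m - k - i))))"
    proof (rule sum.cong[OF refl])
      fix i
      have tri: "(\<phi> gchoose (i + k)) * of_nat ((i + k) choose k) =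
          (\<phi> gchoose k) * ((\<phi> - of_nat k) gchoose i)"
        using gbinomial_trinomial_revision[of k "i + k" \<phi>] by (simp add: binomial_gbinomial)
      have sign: "(-1 :: complex) ^ (i + k) * (-1) ^ k = (-1) ^ i"
        by (simp add: power_add flip: power_mult_distrib)
      have "?g (i + k) = ((-1) ^ (i + k) * (-1) ^ k) *
          ((\<phi> gchoose (i + k)) * of_nat ((i + k) choose k)) *
          ((\<phi> + \<gamma> - of_nat k - of_nat i) gchoose (m - k - i))"
        by (simp add: mult_ac diff_diff_eq add.commute)
      then show "?g (i + k) = (\<phi> gchoose k) * ((-1) ^ i * ((\<phi> - of_nat k) gchoose i) *
        ((\<phi> + \<gamma> - of_nat k - of_nat i) gchoose (m - k - i)))"
        unfolding tri sign by (simp only: mult_ac)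
    qed
    also have "\<dots> = (\<phi> gchoose k) * (\<gamma> gchoose (m - k))"
      by (subst sum_distrib_left[symmetric], subst gbinomial_Vandermonde_alternating) simp
    finally show ?thesis unfolding lhs rhs using True by simp
  qed
qed

text \<open>Coefficient of x^j in t_m / (1 - x)^(n+m+1): the power (1 - x)^i in t_m leaves (1 -
  x)^(-(n+m-i+1)), which contributes the last binomial. The sum collapses by the alternating
  convolution with a = n + m - \<gamma> and b = n + j + m.\<close>

lemma gbinomial_shifted_series_expand:
  fixes \<gamma> :: complex
  shows "((of_nat j + \<gamma>) gchoose m) * of_nat ((j + n) choose n) =
    (\<Sum>i\<le>m. (-1) ^ i * ((of_nat n + of_nat m - \<gamma>) gchoose i) *
      ((of_nat n + of_nat m - of_nat i) gchoose (m - i)) *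
      of_nat ((j + (n + m - i)) choose (n + m - i)))"
proof -
  have "((of_nat n + of_nat m - of_nat i) gchoose (m - i)) * of_nat ((j + (n + m - i)) choose (n + m - i))
      = of_nat ((j + n) choose n) * ((of_nat (n + j + m) - of_nat i :: complex) gchoose (m - i))"
    if "i \<le> m" for i
  proof -
    have 1: "(of_nat n + of_nat m - of_nat i :: complex) = of_nat (n + m - i)"
      and 2: "(of_nat (n + j + m) - of_nat i :: complex) = of_nat (n + j + m - i)"
      using that by (auto simp: of_nat_diff)
    \<comment> \<open>Both sides are the trinomial coefficient (n+j+m-i)! / (n! j! (m-i)!).\<close>
    have "((n + m - i) choose (m - i)) * ((j + (n + m - i)) choose (n + m - i)) =
      ((j + n) choose n) * ((n + j + m - i) choose (m - i))"
      using choose_mult_lemma[of n j "m - i"] that by (simp add: add_ac mult_ac)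
    then show ?thesis unfolding 1 2 binomial_gbinomial[symmetric]
      by (metis of_nat_mult)
  qed
  then have "(\<Sum>i\<le>m. (-1) ^ i * ((of_nat n + of_nat m - \<gamma>) gchoose i) *
      ((of_nat n + of_nat m - of_nat i) gchoose (m - i)) *
      of_nat ((j + (n + m - i)) choose (n + m - i))) =
    of_nat ((j + n) choose n) * (\<Sum>i\<le>m. (-1) ^ i * ((of_nat n + of_nat m - \<gamma>) gchoose i) *
      ((of_nat (n + j + m) - of_nat i) gchoose (m - i)))"
    by (simp add: sum_distrib_left mult.assoc mult.left_commute)
  also have "\<dots> = of_nat ((j + n) choose n) * ((of_nat j + \<gamma>) gchoose m)"
    by (subst gbinomial_Vandermonde_alternating) (simp add: algebra_simps)
  finally show ?thesis by (simp add: mult.commute)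
qed

text \<open>The bridge to \<open>F_op\<close>: for m \<le> n, multiplying by the missing (1 -
  x)^(n-m) gives the exponent 2n + 1 and the weights that define F_n.\<close>

lemma fps_of_poly_t_poly:
  "fps_of_poly (t_poly m (of_nat n + of_nat m - \<gamma>) \<gamma>) =
     (1 - fps_X) ^ (n + m + 1) *
     Abs_fps (\<lambda>j. ((of_nat j + \<gamma>) gchoose m) * of_nat ((j + n) choose n))"
proof -
  let ?c = "\<lambda>i. (-1) ^ i * ((of_nat n + of_nat m - \<gamma>) gchoose i) *
      ((of_nat n + of_nat m - of_nat i) gchoose (m - i))"
  let ?B = "\<lambda>N. Abs_fps (\<lambda>j. of_nat ((j + N) choose N)) :: complex fps"
  have one_minus_X: "fps_of_poly [:1, -1:] = (1 - fps_X :: complex fps)"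
    by (simp add: fps_of_poly_pCons)
  have "Abs_fps (\<lambda>j. ((of_nat j + \<gamma>) gchoose m) * of_nat ((j + n) choose n)) =
      (\<Sum>i\<le>m. fps_const (?c i) * ?B (n + m - i))"
    by (rule fps_ext) (simp add: fps_sum_nth gbinomial_shifted_series_expand)
  then have "(1 - fps_X) ^ (n + m + 1) *
     Abs_fps (\<lambda>j. ((of_nat j + \<gamma>) gchoose m) * of_nat ((j + n) choose n)) =
     (\<Sum>i\<le>m. fps_const (?c i) * ((1 - fps_X) ^ (n + m + 1) * ?B (n + m - i)))"
    by (simp add: sum_distrib_left mult.left_commute del: power_Suc)
  also have "\<dots> = (\<Sum>i\<le>m. fps_const (?c i) * (1 - fps_X) ^ i)"
  proof (rule sum.cong[OF refl])
    fix i assume "i \<in> {..m}"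
    \<comment> \<open>The factor of exponent n + m - i + 1 is exactly the one that cancels
      \<open>?B (n + m - i)\<close>.\<close>
    then have "n + m + 1 = i + (n + m - i + 1)" by simp
    then have "(1 - fps_X :: complex fps) ^ (n + m + 1) = (1 - fps_X) ^ i * (1 - fps_X) ^ (n + m - i + 1)"
      by (simp only: power_add)
    then show "fps_const (?c i) * ((1 - fps_X) ^ (n + m + 1) * ?B (n + m - i)) =
        fps_const (?c i) * (1 - fps_X) ^ i"
      by (simp only: mult.assoc fps_binomial_series mult_1_right)
  qed
  also have "\<dots> = (\<Sum>i\<le>m. fps_const (?c i) * fps_of_poly [:1, -1:] ^ i)"
    unfolding one_minus_X ..
  also have "\<dots> = fps_of_poly (t_poly m (of_nat n + of_nat m - \<gamma>) \<gamma>)"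
    by (simp add: t_poly_expand_at_one fps_of_poly_sum fps_of_poly_smult fps_of_poly_power)
  finally show ?thesis ..
qed

text \<open>Vandermonde splits the rising factorial into binomials in y - p; each of them merges
  with \<open>y gchoose p\<close> into a single binomial in y, with m = p + i.\<close>

lemma poly_F_inv_monom:
  assumes "p \<le> n"
  shows "poly (F_inv_monom n p) y =
    (\<Sum>m = p..n. inverse (of_nat ((n + m) choose m)) * of_nat ((n - p) choose (n - m)) * (y gchoose m))"
proof -
  define N where "N = n - p"
  have n: "n = p + N" using assms by (simp add: N_def)
  have fall: "(\<Prod>i<p. y - of_nat i) = fact p * (y gchoose p)"
    by (simp add: gbinomial_mult_fact lessThan_atLeast0)
  \<comment> \<open>The factors are consecutive and end at y + n + N = (y - p) + 2n, the sum to
    which Vandermonde is applied.\<close>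
  have rise: "(\<Prod>i<N. y + of_nat (n + 1 + i)) = fact N * ((y - of_nat p + of_nat (2 * n)) gchoose N)"
    by (simp add: gbinomial_pochhammer' pochhammer_prod lessThan_atLeast0 n algebra_simps)
  have "poly (F_inv_monom n p) y = fact n / fact (2 * n) * ((\<Prod>i<p. y - of_nat i) *
      (\<Prod>i<N. y + of_nat (n + 1 + i)))"
    by (simp add: F_inv_monom_def poly_prod N_def algebra_simps)
  also have "\<dots> = fact n / fact (2 * n) * (fact p * (y gchoose p) * (fact N *
      (\<Sum>i\<le>N. ((y - of_nat p) gchoose i) * (of_nat (2 * n) gchoose (N - i)))))"
    unfolding fall rise
    by (simp add: atLeast0AtMost[symmetric] gbinomial_Vandermonde del: of_nat_mult)
  also have "\<dots> = (\<Sum>i\<le>N. fact n / fact (2 * n) * fact p * fact N *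
      (((y gchoose p) * ((y - of_nat p) gchoose i)) * of_nat ((2 * n) choose (N - i))))"
    by (simp add: sum_distrib_left mult_ac binomial_gbinomial del: of_nat_mult)
  also have "\<dots> = (\<Sum>i\<le>N. inverse (of_nat ((n + (i + p)) choose (i + p))) *
      of_nat (N choose (n - (i + p))) * (y gchoose (i + p)))"
  proof (rule sum.cong[OF refl])
    fix i assume i: "i \<in> {..N}"
    have tri: "(y gchoose p) * ((y - of_nat p) gchoose i) =
        (y gchoose (i + p)) * of_nat ((i + p) choose p)"
      using gbinomial_trinomial_revision[of p "i + p" y] by (simp add: binomial_gbinomial)
    \<comment> \<open>With every binomial of naturals written in factorials, (2n)!, p! and the
      surplus factorials cancel.\<close>
    have "2 * n - (N - i) = n + (i + p)" "n - (i + p) = N - i" "N - (N - i) = i"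
      using i by (auto simp: n)
    moreover have "(of_nat ((i + p) choose p) :: complex) = fact (i + p) / (fact p * fact i)"
      "(of_nat ((2 * n) choose (N - i)) :: complex) = fact (2 * n) / (fact (N - i) * fact (2 * n - (N - i)))"
      "(of_nat ((n + (i + p)) choose (i + p)) :: complex) = fact (n + (i + p)) / (fact (i + p) * fact n)"
      "(of_nat (N choose (N - i)) :: complex) = fact N / (fact (N - i) * fact (N - (N - i)))"
      using i by (subst binomial_fact; simp add: n)+
    ultimately show "fact n / fact (2 * n) * fact p * fact N *
      (((y gchoose p) * ((y - of_nat p) gchoose i)) * of_nat ((2 * n) choose (N - i))) =
      inverse (of_nat ((n + (i + p)) choose (i + p))) *
      of_nat (N choose (n - (i + p))) * (y gchoose (i + p))"
      unfolding tri by (simp add: mult_ac)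
  qed
  also have "\<dots> = (\<Sum>m = p..n. inverse (of_nat ((n + m) choose m)) *
      of_nat (N choose (n - m)) * (y gchoose m))"
    by (rule sum.reindex_bij_witness[of _ "\<lambda>m. m - p" "\<lambda>i. i + p"]) (auto simp: n)
  finally show ?thesis by (simp add: N_def)
qed

theorem theorem7p2:
  fixes n p :: nat and \<beta> :: complex
  assumes "p \<le> n"
  shows "H_op n \<beta> (monom 1 p) =
    (\<Sum>m = p..n. smult (inverse (of_nat ((n + m) choose m)) * of_nat ((n - p) choose (n - m)))
      ([:1, - 1:] ^ (n - m) *
       t_poly m (- (of_nat n * \<beta>) + of_nat n + of_nat m) (of_nat n * \<beta>)))"
proof -
  define \<gamma> where "\<gamma> = of_nat n * \<beta>"
  let ?c = "\<lambda>m. inverse (of_nat ((n + m) choose m)) * of_nat ((n - p) choose (n - m)) :: complex"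
  let ?S = "\<lambda>m. Abs_fps (\<lambda>j. ((of_nat j + \<gamma>) gchoose m) * of_nat ((j + n) choose n))"
  let ?t = "\<lambda>m. t_poly m (- \<gamma> + of_nat n + of_nat m) \<gamma>"
  have deg: "degree (shift \<gamma> (F_inv_monom n p)) \<le> n"
    using degree_F_inv_monom[OF assms] by (simp add: shift_def degree_pcompose)
  have summand: "fps_of_poly ([:1, -1:] ^ (n - m) * ?t m) = (1 - fps_X) ^ (2 * n + 1) * ?S m"
    if "m \<le> n" for m
  proof -
    have "- \<gamma> + of_nat n + of_nat m = of_nat n + of_nat m - \<gamma>" by simp
    moreover have "2 * n + 1 = (n - m) + (n + m + 1)" using that by simp
    ultimately show ?thesis
      by (simp only: fps_of_poly_mult fps_of_poly_t_poly power_add mult.assoc)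
        (simp add: fps_of_poly_power fps_of_poly_pCons)
  qed
  \<comment> \<open>F_n sees a polynomial only through its values at naturals, so the shift merely
    evaluates the binomial expansion at j + \<gamma>.\<close>
  have series: "Abs_fps (\<lambda>j. poly (shift \<gamma> (F_inv_monom n p)) (of_nat j) * of_nat ((j + n) choose n)) =
      (\<Sum>m = p..n. fps_const (?c m) * ?S m)"
    by (rule fps_ext)
      (simp add: shift_def poly_pcompose poly_F_inv_monom[OF assms] fps_sum_nth sum_distrib_right
        mult.assoc add.commute)
  have "fps_of_poly (H_op n \<beta> (monom 1 p)) =
      (1 - fps_X) ^ (2 * n + 1) * (\<Sum>m = p..n. fps_const (?c m) * ?S m)"
    unfolding H_op_def F_inv_monom_eq[OF assms] \<gamma>_def[symmetric] fps_of_poly_F_op[OF deg] series ..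
  also have "\<dots> = (\<Sum>m = p..n. fps_const (?c m) * ((1 - fps_X) ^ (2 * n + 1) * ?S m))"
    by (simp add: sum_distrib_left mult.left_commute del: power_Suc)
  also have "\<dots> = (\<Sum>m = p..n. fps_const (?c m) * fps_of_poly ([:1, -1:] ^ (n - m) * ?t m))"
    by (intro sum.cong refl) (simp only: summand atLeastAtMost_iff)
  also have "\<dots> = fps_of_poly (\<Sum>m = p..n. smult (?c m) ([:1, -1:] ^ (n - m) * ?t m))"
    by (simp only: fps_of_poly_sum fps_of_poly_smult)
  finally show ?thesis by (simp only: fps_of_poly_eq_iff \<gamma>_def)
qed

end
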